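(* Let $d\ge 1$ and $1\le k\le d$ be integers, and let $m\ge 4k-2$. Then a set $\mathcal F=\{f_1,\dots,f_m\}$ of $m$ generically chosen vectors in $\mathbb C^d$ is $k$-sparse phase retrievable.
   Context: Let $\mathbb C^d_k=\{x\in\mathbb C^d:\|x\|_0\le k\}$, where $\|x\|_0$ is the number of nonzero entries of $x$. A family $\mathcal F=\{f_1,\dots,f_m\}$ of vectors in $\mathbb C^d$ is called $k$-sparse phase retrievable if, for all $x,y\in\mathbb C^d_k$, the equalities $|\langle x,f_j\rangle|=|\langle y,f_j\rangle|$ for $j=1,\dots,m$ imply $x=cy$ for some $c\in\mathbb C$ with $|c|=1$. "Generically chosen" means: identifying $(f_1,\dots,f_m)\in\mathbb C^{d\times m}$ with a point of $\mathbb R^{2md}$ (real and imaginary parts of the entries), the property holds for all points outside some proper real algebraic subset of $\mathbb R^{2md}$ (i.e. outside the common zero set of some family of real polynomials, not all identically zero). *)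

theory Defs
  imports "HOL-Analysis.Analysis"
begin

text \<open>
  Vectors in \<open>\<complex>\<^sup>d\<close> are elements of \<open>complex ^ 'd\<close> with \<open>d = CARD('d)\<close>. A family
  \<open>f\<^sub>1, \<dots>, f\<^sub>m\<close> of such vectors is an element \<open>F\<close> of \<open>complex ^ 'd ^ 'm\<close> with \<open>m = CARD('m)\<close>
  and \<open>f\<^sub>j = F $ j\<close> (the vectors are the rows of \<open>F\<close>).
\<close>

definition l0_norm :: "complex ^ 'd \<Rightarrow> nat" where
  "l0_norm x = card {i. x $ i \<noteq> 0}"

definition sparse_vectors :: "nat \<Rightarrow> (complex ^ 'd) set" where
  "sparse_vectors k = {x. l0_norm x \<le> k}"

text \<open>
  The library's \<open>x \<bullet> y\<close> on \<open>complex ^ 'd\<close> is only the real part of the Hermitian inner product.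
\<close>

definition hermitian_inner :: "complex ^ 'd \<Rightarrow> complex ^ 'd \<Rightarrow> complex" where
  "hermitian_inner x y = (\<Sum>i\<in>UNIV. x $ i * cnj (y $ i))"

definition sparse_phase_retrievable :: "nat \<Rightarrow> complex ^ 'd ^ 'm \<Rightarrow> bool" where
  "sparse_phase_retrievable k F \<longleftrightarrow>
    (\<forall>x\<in>sparse_vectors k. \<forall>y\<in>sparse_vectors k.
      (\<forall>j. cmod (hermitian_inner x (F $ j)) = cmod (hermitian_inner y (F $ j))) \<longrightarrow>
      (\<exists>c. cmod c = 1 \<and> x = c *s y))"

text \<open>
  On a Euclidean space, \<^const>\<open>real_polynomial_function\<close> describes exactly the functions given by
  real polynomials in the coordinates. Since the field is infinite, a polynomial is zero iff it
  induces the zero function.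
\<close>

definition proper_real_algebraic :: "'a::euclidean_space set \<Rightarrow> bool" where
  "proper_real_algebraic Z \<longleftrightarrow>
    (\<exists>P. (\<forall>p\<in>P. real_polynomial_function p) \<and> (\<exists>p\<in>P. p \<noteq> (\<lambda>_. 0)) \<and>
      Z = {z. \<forall>p\<in>P. p z = 0})"

text \<open>The identification of \<open>\<complex>\<^bsup>d\<times>m\<^esup>\<close> with \<open>\<real>\<^bsup>2md\<^esup>\<close>: all real parts, then all imaginary parts.\<close>

definition re_im_parts :: "complex ^ 'd ^ 'm \<Rightarrow> (real ^ 'd ^ 'm) \<times> (real ^ 'd ^ 'm)" where
  "re_im_parts F = ((\<chi> j i. Re (F $ j $ i)), (\<chi> j i. Im (F $ j $ i)))"

definition holds_generically :: "(complex ^ 'd ^ 'm \<Rightarrow> bool) \<Rightarrow> bool" where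
  "holds_generically Q \<longleftrightarrow>
    (\<exists>Z. proper_real_algebraic Z \<and> (\<forall>F. re_im_parts F \<notin> Z \<longrightarrow> Q F))"

end

theory Submission
  imports Defs
begin

text \<open>
  If \<open>F\<close> fails for the pair \<open>x, y\<close>, then after normalisation the pair has \<open>4 k - 3\<close> real
  parameters, and \<open>\<bar>\<langle>x, f\<^sub>j\<rangle>\<bar> = \<bar>\<langle>y, f\<^sub>j\<rangle>\<bar>\<close> says that \<open>f\<^sub>j\<close> is orthogonal to \<open>x - u\<^sub>j y\<close> for some
  unimodular \<open>u\<^sub>j\<close>. This vector is nonzero, so one entry of \<open>f\<^sub>j\<close> is determined by the others;
  parametrising \<open>u\<^sub>j\<close> rationally, each \<open>f\<^sub>j\<close> contributes \<open>2 d - 1\<close> real parameters. Hence the bad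
  families are covered by finitely many rational charts with \<open>m (2 d - 1) + 4 k - 3 < 2 m d\<close>
  parameters. Comparing the number of polynomials of bounded degree in the \<open>2 m d\<close> coordinates
  with the number of monomials in the parameters yields a nonzero polynomial that vanishes on
  all charts, which avoids Zariski closures of semialgebraic sets.
\<close>

section \<open>Linear algebra: underdetermined homogeneous systems\<close>

lemma homogeneous_system_nontrivial_solution:
  fixes M :: "'b \<Rightarrow> 'a \<Rightarrow> real"
  assumes "finite B" "finite A" "card B < card A"
  shows "\<exists>c. (\<exists>a\<in>A. c a \<noteq> 0) \<and> (\<forall>b\<in>B. (\<Sum>a\<in>A. c a * M b a) = 0)"
  using assms
proof (induction B arbitrary: A M rule: finite_induct)
  case empty
  then have "A \<noteq> {}" by auto
  then show ?case by (auto intro!: exI[of _ "\<lambda>_. 1::real"])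
next
  case (insert b B)
  show ?case
  proof (cases "\<forall>a\<in>A. M b a = 0")
    case True
    have "card B < card A" using insert by simp
    from insert.IH[OF insert.prems(1) this, of M] show ?thesis
      using True by auto
  next
    case False
    then obtain a0 where a0: "a0 \<in> A" "M b a0 \<noteq> 0" by auto
    define A' where "A' = A - {a0}"
    have A': "finite A'" "card B < card A'" "A = insert a0 A'" "a0 \<notin> A'"
      using insert a0 by (auto simp: A'_def)
    obtain c' where c': "\<exists>a\<in>A'. c' a \<noteq> 0"
      "\<And>b'. b' \<in> B \<Longrightarrow> (\<Sum>a\<in>A'. c' a * (M b' a - M b' a0 * M b a / M b a0)) = 0"
      using insert.IH[OF A'(1,2), of "\<lambda>b' a. M b' a - M b' a0 * M b a / M b a0"] by blast
    define S where "S = (\<Sum>a\<in>A'. c' a * M b a)"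
    define c where "c = c'(a0 := - S / M b a0)"
    have sum_c: "(\<Sum>a\<in>A. c a * M b' a) = - S / M b a0 * M b' a0 + (\<Sum>a\<in>A'. c' a * M b' a)" for b'
    proof -
      have "(\<Sum>a\<in>A'. c a * M b' a) = (\<Sum>a\<in>A'. c' a * M b' a)"
        using A'(4) by (intro sum.cong) (auto simp: c_def)
      then show ?thesis using A' by (simp add: c_def)
    qed
    have "(\<Sum>a\<in>A. c a * M b' a) = 0" if "b' \<in> insert b B" for b'
    proof (cases "b' = b")
      case True
      then show ?thesis using a0 by (simp add: sum_c S_def)
    next
      case False
      then have "b' \<in> B" using that by simp
      have "(\<Sum>a\<in>A'. c' a * (M b' a - M b' a0 * M b a / M b a0))
          = (\<Sum>a\<in>A'. c' a * M b' a) - (\<Sum>a\<in>A'. M b' a0 / M b a0 * (c' a * M b a))"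
        by (simp add: algebra_simps sum_subtractf)
      also have "\<dots> = (\<Sum>a\<in>A'. c' a * M b' a) - M b' a0 / M b a0 * S"
        by (simp add: S_def sum_distrib_left)
      finally show ?thesis using c'(2)[OF \<open>b' \<in> B\<close>] by (simp add: sum_c)
    qed
    moreover have "\<exists>a\<in>A. c a \<noteq> 0"
      using c'(1) A' by (auto simp: c_def)
    ultimately show ?thesis by blast
  qed
qed

section \<open>Polynomials of bounded degree in each variable\<close>

text \<open>Bounding the degree in each variable separately gives \<open>(e + 1) ^ card I\<close>
  exponent vectors for finite \<open>I\<close>, which keeps the dimension count elementary.\<close>

definition box_poly :: "'p set \<Rightarrow> nat \<Rightarrow> (('p \<Rightarrow> real) \<Rightarrow> real) \<Rightarrow> bool" where
  "box_poly I e f \<longleftrightarrow>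
    (\<exists>c. \<forall>g. f g = (\<Sum>b\<in>PiE I (\<lambda>_. {..e}). c b * (\<Prod>i\<in>I. g i ^ b i)))"

lemma box_poly_monomial:
  assumes "finite I" "\<And>i. i \<in> I \<Longrightarrow> b i \<le> e"
  shows "box_poly I e (\<lambda>g. c * (\<Prod>i\<in>I. g i ^ b i))"
proof -
  \<comment> \<open>Members of \<open>PiE\<close> are \<open>undefined\<close> outside
    \<open>I\<close>, so the exponents have to be cut down to \<open>I\<close> first.\<close>
  define b' where "b' = restrict b I"
  have b': "b' \<in> PiE I (\<lambda>_. {..e})" using assms by (auto simp: b'_def)
  have fin: "finite (PiE I (\<lambda>_. {..e}))" using assms by (intro finite_PiE) auto
  have "c * (\<Prod>i\<in>I. g i ^ b i)
      = (\<Sum>b\<in>PiE I (\<lambda>_. {..e}). (if b = b' then c else 0) * (\<Prod>i\<in>I. g i ^ b i))" for g :: "'a \<Rightarrow> real"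
  proof -
    have "(\<Sum>b\<in>PiE I (\<lambda>_. {..e}). (if b = b' then c else 0) * (\<Prod>i\<in>I. g i ^ b i))
        = (\<Sum>b\<in>PiE I (\<lambda>_. {..e}). if b' = b then c * (\<Prod>i\<in>I. g i ^ b i) else 0)"
      by (intro sum.cong) auto
    also have "\<dots> = c * (\<Prod>i\<in>I. g i ^ b' i)" using fin b' by simp
    also have "(\<Prod>i\<in>I. g i ^ b' i) = (\<Prod>i\<in>I. g i ^ b i)"
      by (intro prod.cong) (auto simp: b'_def)
    finally show ?thesis by simp
  qed
  then show ?thesis
    unfolding box_poly_def by (intro exI[of _ "\<lambda>b. if b = b' then c else 0"] allI)
qed

lemma box_poly_sum:
  assumes "\<And>x. x \<in> X \<Longrightarrow> box_poly I e (f x)"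
  shows "box_poly I e (\<lambda>g. \<Sum>x\<in>X. f x g)"
proof -
  obtain c where c: "\<And>x g. x \<in> X \<Longrightarrow> f x g = (\<Sum>b\<in>PiE I (\<lambda>_. {..e}). c x b * (\<Prod>i\<in>I. g i ^ b i))"
    using assms unfolding box_poly_def by metis
  have "(\<Sum>x\<in>X. f x g)
      = (\<Sum>b\<in>PiE I (\<lambda>_. {..e}). (\<Sum>x\<in>X. c x b) * (\<Prod>i\<in>I. g i ^ b i))" for g
    by (simp add: c sum_distrib_right cong: sum.cong) (rule sum.swap)
  then show ?thesis unfolding box_poly_def by (intro exI allI)
qed

lemma box_poly_mult:
  assumes "finite I" "box_poly I e f" "box_poly I e' f'"
  shows "box_poly I (e + e') (\<lambda>g. f g * f' g)"
proof -
  let ?B = "\<lambda>e. PiE I (\<lambda>_. {..e::nat})"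
  obtain c where c: "\<And>g. f g = (\<Sum>b\<in>?B e. c b * (\<Prod>i\<in>I. g i ^ b i))"
    using assms(2) unfolding box_poly_def by blast
  obtain c' where c': "\<And>g. f' g = (\<Sum>b\<in>?B e'. c' b * (\<Prod>i\<in>I. g i ^ b i))"
    using assms(3) unfolding box_poly_def by blast
  have "(\<lambda>g. f g * f' g)
      = (\<lambda>g. \<Sum>b\<in>?B e. \<Sum>b'\<in>?B e'. (c b * c' b') * (\<Prod>i\<in>I. g i ^ (b i + b' i)))"
    unfolding c c' sum_product by (simp add: power_add prod.distrib mult_ac)
  moreover have "box_poly I (e + e')
      (\<lambda>g. \<Sum>b\<in>?B e. \<Sum>b'\<in>?B e'. (c b * c' b') * (\<Prod>i\<in>I. g i ^ (b i + b' i)))"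
    using assms(1) by (intro box_poly_sum box_poly_monomial) (auto intro!: add_mono simp: PiE_def Pi_def)
  ultimately show ?thesis by simp
qed

lemma box_poly_const: "finite I \<Longrightarrow> box_poly I e (\<lambda>_. c)"
  using box_poly_monomial[of I "\<lambda>_. 0" e c] by simp

lemma box_poly_var:
  assumes "finite I" "i \<in> I"
  shows "box_poly I 1 (\<lambda>g. g i)"
proof -
  have "(\<Prod>j\<in>I. g j ^ (if j = i then 1 else 0)) = g i" for g :: "'a \<Rightarrow> real"
  proof -
    have "(\<Prod>j\<in>I. g j ^ (if j = i then 1 else 0)) = (\<Prod>j\<in>I. if i = j then g j else 1)"
      by (intro prod.cong) auto
    then show ?thesis using assms by simp
  qed
  then show ?thesis
    using box_poly_monomial[OF assms(1), of "\<lambda>j. if j = i then 1 else 0" 1 1] by simp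
qed

text \<open>Multiply by the constant 1, regarded as having degree \<open>e' - e\<close>.\<close>

lemma box_poly_mono:
  assumes "finite I" "box_poly I e f" "e \<le> e'"
  shows "box_poly I e' f"
  using box_poly_mult[OF assms(1,2) box_poly_const[OF assms(1), of "e' - e" 1]] assms(3) by simp

lemma box_poly_add:
  assumes "box_poly I e f" "box_poly I e f'"
  shows "box_poly I e (\<lambda>g. f g + f' g)"
  using box_poly_sum[of UNIV I e "\<lambda>b. if b then f else f'"] assms by (simp add: UNIV_bool add.commute)

lemma box_poly_prod:
  assumes "finite I" "finite X" "\<And>x. x \<in> X \<Longrightarrow> box_poly I (e x) (f x)"
  shows "box_poly I (\<Sum>x\<in>X. e x) (\<lambda>g. \<Prod>x\<in>X. f x g)"
  using assms(2,3)
  by (induction X rule: finite_induct) (simp_all add: box_poly_const box_poly_mult assms(1))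

section \<open>Real and complex valued polynomials of unspecified degree\<close>

definition is_poly :: "'p set \<Rightarrow> (('p \<Rightarrow> real) \<Rightarrow> real) \<Rightarrow> bool" where
  "is_poly I f \<longleftrightarrow> finite I \<and> (\<exists>e. box_poly I e f)"

lemma is_polyI: "finite I \<Longrightarrow> box_poly I e f \<Longrightarrow> is_poly I f"
  by (auto simp: is_poly_def)

lemma is_poly_const: "finite I \<Longrightarrow> is_poly I (\<lambda>_. c)"
  by (rule is_polyI[OF _ box_poly_const])

lemma is_poly_var: "finite I \<Longrightarrow> i \<in> I \<Longrightarrow> is_poly I (\<lambda>g. g i)"
  by (rule is_polyI[OF _ box_poly_var])

lemma
  assumes "is_poly I f" "is_poly I f'"
  shows is_poly_mult: "is_poly I (\<lambda>g. f g * f' g)"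
    and is_poly_add: "is_poly I (\<lambda>g. f g + f' g)"
proof -
  obtain e e' where *: "finite I" "box_poly I e f" "box_poly I e' f'"
    using assms unfolding is_poly_def by auto
  show "is_poly I (\<lambda>g. f g * f' g)"
    by (rule is_polyI[OF *(1) box_poly_mult[OF *]])
  have "box_poly I (e + e') f" "box_poly I (e + e') f'"
    using box_poly_mono[OF *(1,2)] box_poly_mono[OF *(1,3)] by simp_all
  then show "is_poly I (\<lambda>g. f g + f' g)"
    by (rule is_polyI[OF *(1) box_poly_add])
qed

lemma is_poly_uminus:
  assumes "is_poly I f"
  shows "is_poly I (\<lambda>g. - f g)"
proof -
  have "finite I" using assms by (simp add: is_poly_def)
  from is_poly_mult[OF is_poly_const[OF this, of "-1"] assms] show ?thesis by simp
qed

lemma is_poly_diff: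
  assumes "is_poly I f" "is_poly I f'"
  shows "is_poly I (\<lambda>g. f g - f' g)"
  using is_poly_add[OF assms(1) is_poly_uminus[OF assms(2)]] by simp

lemma is_poly_sum:
  assumes "finite I" "\<And>x. x \<in> X \<Longrightarrow> is_poly I (f x)"
  shows "is_poly I (\<lambda>g. \<Sum>x\<in>X. f x g)"
  using assms(2)
  by (induction X rule: infinite_finite_induct)
    (simp_all add: is_poly_const[OF assms(1)] is_poly_add)

definition is_complex_poly :: "'p set \<Rightarrow> (('p \<Rightarrow> real) \<Rightarrow> complex) \<Rightarrow> bool" where
  "is_complex_poly I f \<longleftrightarrow> is_poly I (\<lambda>g. Re (f g)) \<and> is_poly I (\<lambda>g. Im (f g))"

lemma is_complex_poly_const: "finite I \<Longrightarrow> is_complex_poly I (\<lambda>_. c)"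
  by (simp add: is_complex_poly_def is_poly_const)

lemma is_complex_poly_Complex:
  "is_poly I a \<Longrightarrow> is_poly I b \<Longrightarrow> is_complex_poly I (\<lambda>g. Complex (a g) (b g))"
  by (simp add: is_complex_poly_def)

lemma is_complex_poly_cnj: "is_complex_poly I f \<Longrightarrow> is_complex_poly I (\<lambda>g. cnj (f g))"
  by (simp add: is_complex_poly_def is_poly_uminus)

lemma is_complex_poly_mult:
  "is_complex_poly I f \<Longrightarrow> is_complex_poly I f' \<Longrightarrow> is_complex_poly I (\<lambda>g. f g * f' g)"
  by (simp add: is_complex_poly_def is_poly_mult is_poly_add is_poly_diff)

lemma is_complex_poly_diff:
  "is_complex_poly I f \<Longrightarrow> is_complex_poly I f' \<Longrightarrow> is_complex_poly I (\<lambda>g. f g - f' g)"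
  by (simp add: is_complex_poly_def is_poly_diff)

lemma is_complex_poly_sum:
  "finite I \<Longrightarrow> (\<And>x. x \<in> X \<Longrightarrow> is_complex_poly I (f x)) \<Longrightarrow> is_complex_poly I (\<lambda>g. \<Sum>x\<in>X. f x g)"
  by (simp add: is_complex_poly_def is_poly_sum)

section \<open>Interpolation polynomials and the dimension count\<close>

text \<open>
  Up to a constant factor, this is the Lagrange basis polynomial of the grid
  \<open>{0, \<dots>, D}\<^bsup>CARD('i)\<^esup>\<close> at the node \<open>a\<close>. Compared with monomials, nonzero linear
  combinations of these are immediately seen to be nonzero functions.
\<close>

definition lagrange :: "nat \<Rightarrow> ('i::finite \<Rightarrow> nat) \<Rightarrow> ('i \<Rightarrow> real) \<Rightarrow> real" where
  "lagrange D a z = (\<Prod>i\<in>UNIV. \<Prod>l\<in>{..D} - {a i}. z i - real l)"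

text \<open>Where \<open>a\<close> and \<open>b\<close> differ in a coordinate \<open>i\<close>, the
  factor with \<open>l = b i\<close> is present, because \<open>b i \<le> D\<close> and only
  \<open>a i\<close> is left out; it vanishes at \<open>b\<close>. For \<open>a = b\<close> exactly
  the vanishing factors are left out.\<close>

lemma lagrange_at_node:
  assumes "\<And>i. b i \<le> D"
  shows "lagrange D a (\<lambda>i. real (b i)) \<noteq> 0 \<longleftrightarrow> a = b"
  using assms by (auto simp: lagrange_def fun_eq_iff)

text \<open>Removing \<open>a i\<close> from \<open>{..D}\<close> leaves exactly \<open>D\<close>
  factors of degree \<open>e\<close> per coordinate, so the degree grows only linearly in
  \<open>D\<close>.\<close>

lemma box_poly_homogenized_lagrange:
  fixes p h :: "'i::finite \<Rightarrow> ('p \<Rightarrow> real) \<Rightarrow> real"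
  assumes "finite I" "\<And>i. box_poly I e (p i)" "\<And>i. box_poly I e (h i)" "\<And>i. a i \<le> D"
  shows "box_poly I (CARD('i) * (D * e))
    (\<lambda>g. \<Prod>i\<in>UNIV. \<Prod>l\<in>{..D} - {a i}. p i g - real l * h i g)"
proof -
  have 1: "box_poly I e (\<lambda>g. p i g - real l * h i g)" for i l
    using box_poly_add[OF assms(2)[of i], of "\<lambda>g. - real l * h i g"]
      box_poly_mult[OF assms(1) box_poly_const[OF assms(1), of 0 "- real l"] assms(3)[of i]]
    by simp
  have "box_poly I (\<Sum>l\<in>{..D} - {a i}. e) (\<lambda>g. \<Prod>l\<in>{..D} - {a i}. p i g - real l * h i g)" for i
    by (intro box_poly_prod assms(1) 1) auto
  moreover have card: "card ({..D} - {a i}) = D" for i using assms(4)[of i] by simp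
  ultimately have "box_poly I (D * e) (\<lambda>g. \<Prod>l\<in>{..D} - {a i}. p i g - real l * h i g)" for i
    using assms(4)[of i] by (simp only: card sum_constant of_nat_id)
  then have "box_poly I (\<Sum>i\<in>(UNIV::'i set). D * e)
     (\<lambda>g. \<Prod>i\<in>UNIV. \<Prod>l\<in>{..D} - {a i}. p i g - real l * h i g)"
    by (intro box_poly_prod assms(1)) auto
  then show ?thesis by simp
qed

text \<open>Each factor is multiplied by its denominator. Every coordinate has \<open>D\<close>
  factors whatever the node, so the cleared denominator is the same for all \<open>a\<close> and can
  be pulled out of a linear combination.\<close>

lemma homogenized_lagrange:
  fixes p h :: "'i::finite \<Rightarrow> real"
  assumes "\<And>i. z i * h i = p i" "\<And>i. a i \<le> D"
  shows "(\<Prod>i\<in>UNIV. \<Prod>l\<in>{..D} - {a i}. p i - real l * h i) = (\<Prod>i\<in>UNIV. h i) ^ D * lagrange D a z"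
proof -
  have "(\<Prod>l\<in>{..D} - {a i}. p i - real l * h i) = h i ^ D * (\<Prod>l\<in>{..D} - {a i}. z i - real l)" for i
  proof -
    have "(\<Prod>l\<in>{..D} - {a i}. p i - real l * h i) = (\<Prod>l\<in>{..D} - {a i}. h i * (z i - real l))"
      by (intro prod.cong) (simp_all add: assms(1)[symmetric] algebra_simps)
    also have "\<dots> = h i ^ card ({..D} - {a i}) * (\<Prod>l\<in>{..D} - {a i}. z i - real l)"
      by (simp only: prod.distrib prod_constant)
    finally show ?thesis using assms(2)[of i] by simp
  qed
  then show ?thesis by (simp add: lagrange_def prod.distrib prod_power_distrib)
qed

text \<open>
  All charts are treated at once by one dimension count: \<open>(D + 1)\<^bsup>N\<^esup>\<close> coefficients against
  \<open>O((D + 1)\<^bsup>N - 1\<^esup>)\<close> linear conditions, where \<open>N = CARD('i)\<close>.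
\<close>

lemma rational_charts_in_hypersurface:
  fixes C :: "'c set" and I :: "'c \<Rightarrow> 'p set"
    and p h :: "'c \<Rightarrow> 'i::finite \<Rightarrow> ('p \<Rightarrow> real) \<Rightarrow> real"
  assumes "finite C"
    and card: "\<And>\<kappa>. \<kappa> \<in> C \<Longrightarrow> card (I \<kappa>) < CARD('i)"
    and p: "\<And>\<kappa> i. \<kappa> \<in> C \<Longrightarrow> is_poly (I \<kappa>) (p \<kappa> i)"
    and h: "\<And>\<kappa> i. \<kappa> \<in> C \<Longrightarrow> is_poly (I \<kappa>) (h \<kappa> i)"
  shows "\<exists>D c. (\<exists>z. (\<Sum>a\<in>UNIV \<rightarrow> {..D}. c a * lagrange D a z) \<noteq> 0) \<and>
    (\<forall>\<kappa>\<in>C. \<forall>g z. (\<forall>i. h \<kappa> i g \<noteq> 0 \<and> z i * h \<kappa> i g = p \<kappa> i g) \<longrightarrow>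
      (\<Sum>a\<in>UNIV \<rightarrow> {..D}. c a * lagrange D a z) = 0)"
proof -
  have fin: "finite (I \<kappa>)" if "\<kappa> \<in> C" for \<kappa>
    using p[OF that] by (auto simp: is_poly_def)
  define N where "N = CARD('i)"
  have N: "N > 0" by (simp add: N_def)
  obtain ep eh where ep: "\<And>\<kappa> i. \<kappa> \<in> C \<Longrightarrow> box_poly (I \<kappa>) (ep \<kappa> i) (p \<kappa> i)"
    and eh: "\<And>\<kappa> i. \<kappa> \<in> C \<Longrightarrow> box_poly (I \<kappa>) (eh \<kappa> i) (h \<kappa> i)"
    using p h unfolding is_poly_def by metis
  define e where "e = (\<Sum>\<kappa>\<in>C. \<Sum>i\<in>UNIV. ep \<kappa> i + eh \<kappa> i)"
  have le_e: "ep \<kappa> i + eh \<kappa> i \<le> e" if "\<kappa> \<in> C" for \<kappa> i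
  proof -
    have "ep \<kappa> i + eh \<kappa> i \<le> (\<Sum>i\<in>UNIV. ep \<kappa> i + eh \<kappa> i)"
      by (rule member_le_sum) auto
    also have "\<dots> \<le> e" unfolding e_def using that assms(1)
      by (intro member_le_sum[where f = "\<lambda>\<kappa>. \<Sum>i\<in>UNIV. ep \<kappa> i + eh \<kappa> i"]) auto
    finally show ?thesis .
  qed
  have pe: "box_poly (I \<kappa>) e (p \<kappa> i)" and he: "box_poly (I \<kappa>) e (h \<kappa> i)" if "\<kappa> \<in> C" for \<kappa> i
    using box_poly_mono[OF fin ep] box_poly_mono[OF fin eh] le_e[OF that, of i] that by auto
  \<comment> \<open>Since \<open>E + 1 \<le> (N * e + 1) * (D + 1)\<close>, this \<open>D\<close>
    bounds the number of equations by \<open>D * (D + 1) ^ (N - 1)\<close>, which is less than the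
    number \<open>(D + 1) ^ N\<close> of unknowns.\<close>
  define D where "D = card C * (N * e + 1) ^ (N - 1)"
  define E where "E = N * (D * e)"
  define A where "A = (UNIV :: 'i set) \<rightarrow> {..D}"
  have A_PiE: "A = PiE UNIV (\<lambda>_. {..D})" by (auto simp: A_def PiE_def)
  have A: "finite A" "card A = (D + 1) ^ N"
    unfolding A_PiE by (auto simp: finite_PiE card_PiE N_def)
  \<comment> \<open>One equation for each chart and each monomial in its parameters.\<close>
  define B where "B = Sigma C (\<lambda>\<kappa>. PiE (I \<kappa>) (\<lambda>_. {..E}))"
  have finB: "finite B"
    unfolding B_def using assms(1) fin by (auto intro!: finite_PiE)
  have "card B = (\<Sum>\<kappa>\<in>C. (E + 1) ^ card (I \<kappa>))"
    unfolding B_def using assms(1) fin by (subst card_SigmaI) (auto intro!: finite_PiE sum.cong simp: card_PiE)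
  also have "\<dots> \<le> (\<Sum>\<kappa>\<in>C. (E + 1) ^ (N - 1))"
    using card by (intro sum_mono power_increasing) (fastforce simp: N_def)+
  also have "\<dots> = card C * (E + 1) ^ (N - 1)" by simp
  also have "\<dots> \<le> card C * ((N * e + 1) * (D + 1)) ^ (N - 1)"
    by (intro mult_left_mono power_mono) (auto simp: E_def algebra_simps)
  also have "\<dots> = D * (D + 1) ^ (N - 1)" by (simp add: D_def power_mult_distrib del: One_nat_def)
  also have "\<dots> < (D + 1) * (D + 1) ^ (N - 1)" by simp
  also have "\<dots> = (D + 1) ^ N" using N by (cases N) simp_all
  finally have lt: "card B < card A" using A by simp

  \<comment> \<open>The basis polynomial at node \<open>a\<close>, pulled back along the chart, with
    denominators cleared.\<close>
  define q where "q \<kappa> a g = (\<Prod>i\<in>UNIV. \<Prod>l\<in>{..D} - {a i}. p \<kappa> i g - real l * h \<kappa> i g)"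
    for \<kappa> a g
  have "box_poly (I \<kappa>) E (q \<kappa> a)" if "\<kappa> \<in> C" "a \<in> A" for \<kappa> a
    unfolding q_def[abs_def] E_def N_def using that
    by (intro box_poly_homogenized_lagrange fin pe he) (auto simp: A_def)
  then obtain M where M: "\<And>\<kappa> a g. \<kappa> \<in> C \<Longrightarrow> a \<in> A \<Longrightarrow>
      q \<kappa> a g = (\<Sum>b\<in>PiE (I \<kappa>) (\<lambda>_. {..E}). M \<kappa> a b * (\<Prod>i\<in>I \<kappa>. g i ^ b i))"
    unfolding box_poly_def by metis
  obtain c where c: "\<exists>a\<in>A. c a \<noteq> 0"
      "\<And>q. q \<in> B \<Longrightarrow> (\<Sum>a\<in>A. c a * M (fst q) a (snd q)) = 0"
    using homogeneous_system_nontrivial_solution[OF finB A(1) lt,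
        of "\<lambda>q a. M (fst q) a (snd q)"]
    by blast
  \<comment> \<open>Evaluating at the node of a nonzero coefficient isolates that
    coefficient.\<close>
  obtain a0 where a0: "a0 \<in> A" "c a0 \<noteq> 0" using c(1) by blast
  have node: "lagrange D a (\<lambda>i. real (a0 i)) \<noteq> 0 \<longleftrightarrow> a = a0" for a
    using a0 by (intro lagrange_at_node) (auto simp: A_def)
  have "(\<Sum>a\<in>A. c a * lagrange D a (\<lambda>i. real (a0 i)))
      = (\<Sum>a\<in>A. if a0 = a then c a * lagrange D a (\<lambda>i. real (a0 i)) else 0)"
    using node by (intro sum.cong) auto
  also have "\<dots> = c a0 * lagrange D a0 (\<lambda>i. real (a0 i))" using A a0 by simp
  also have "\<dots> \<noteq> 0" using a0 node by simp
  finally have nz: "(\<Sum>a\<in>A. c a * lagrange D a (\<lambda>i. real (a0 i))) \<noteq> 0" .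
  have "(\<Sum>a\<in>A. c a * lagrange D a z) = 0"
    if \<kappa>: "\<kappa> \<in> C" and gz: "\<And>i. h \<kappa> i g \<noteq> 0 \<and> z i * h \<kappa> i g = p \<kappa> i g" for \<kappa> g z
  proof -
    \<comment> \<open>The factor \<open>?H\<close> is nonzero and common to all \<open>a\<close>, so
      it is enough that the cleared sum vanishes; the coefficients of that sum are the equations
      indexed by \<open>B\<close>.\<close>
    let ?H = "(\<Prod>i\<in>UNIV. h \<kappa> i g) ^ D"
    have "?H * (\<Sum>a\<in>A. c a * lagrange D a z) = (\<Sum>a\<in>A. c a * q \<kappa> a g)"
      unfolding sum_distrib_left
    proof (intro sum.cong refl)
      fix a assume "a \<in> A"
      then have "q \<kappa> a g = ?H * lagrange D a z"
        unfolding q_def using gz by (intro homogenized_lagrange) (auto simp: A_def)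
      then show "?H * (c a * lagrange D a z) = c a * q \<kappa> a g" by simp
    qed
    also have "\<dots> = (\<Sum>a\<in>A. \<Sum>b\<in>PiE (I \<kappa>) (\<lambda>_. {..E}). c a * M \<kappa> a b * (\<Prod>i\<in>I \<kappa>. g i ^ b i))"
      using \<kappa> by (simp add: M sum_distrib_left mult.assoc)
    also have "\<dots> = (\<Sum>b\<in>PiE (I \<kappa>) (\<lambda>_. {..E}). (\<Sum>a\<in>A. c a * M \<kappa> a b) * (\<Prod>i\<in>I \<kappa>. g i ^ b i))"
      by (subst sum.swap) (simp add: sum_distrib_right)
    also have "\<dots> = 0" using \<kappa> c(2)[of "(\<kappa>, _)"] by (intro sum.neutral) (simp add: B_def)
    finally show ?thesis using gz by auto
  qed
  then show ?thesis using nz unfolding A_def by blast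
qed

lemma real_polynomial_function_prod:
  "finite X \<Longrightarrow> (\<And>x. x \<in> X \<Longrightarrow> real_polynomial_function (f x)) \<Longrightarrow>
    real_polynomial_function (\<lambda>z. \<Prod>x\<in>X. f x z)"
  by (induction X rule: finite_induct) auto

lemma real_polynomial_function_lagrange:
  assumes "\<And>i. real_polynomial_function (\<lambda>z. \<phi> z i)"
  shows "real_polynomial_function (\<lambda>z. lagrange D a (\<phi> z))"
  unfolding lagrange_def
  by (intro real_polynomial_function_prod real_polynomial_function_diff assms
      real_polynomial_function.intros(2)) auto

section \<open>Rational parametrisation of the phase\<close>

text \<open>The quotients \<open>(1 + i t) / (1 - i t)\<close> with real \<open>t\<close> fill the
  unit circle except for \<open>-1\<close>, which the sign supplies at \<open>t = 0\<close>. Without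
  denominators the identity also covers \<open>a = b = 0\<close>.\<close>

lemma equal_modulus_linearized:
  assumes "cmod a = cmod b"
  shows "\<exists>\<sigma> t. (\<sigma> = 1 \<or> \<sigma> = -1) \<and> Complex 1 (- t) * a = \<sigma> * Complex 1 t * b"
proof (cases "a = - b")
  case True
  then show ?thesis by (intro exI[of _ "-1"] exI[of _ 0]) (simp add: complex_eq_iff)
next
  case False
  show ?thesis
  proof (cases "b = 0")
    case True
    with assms show ?thesis by auto
  next
    case b: False
    define u where "u = a / b"
    have u: "cmod u = 1" "u \<noteq> -1" "a = u * b"
      using assms b False by (auto simp: u_def norm_divide field_simps)
    have u2: "(Re u)\<^sup>2 + (Im u)\<^sup>2 = 1" using u(1) by (metis cmod_power2 one_power2)
    have r: "1 + Re u \<noteq> 0"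
    proof
      assume "1 + Re u = 0"
      then have "Re u = -1" by simp
      with u2 have "Im u = 0" by simp
      with \<open>Re u = -1\<close> u(2) show False by (simp add: complex_eq_iff)
    qed
    \<comment> \<open>The tangent of half the argument of \<open>u\<close>.\<close>
    define t where "t = Im u / (1 + Re u)"
    have t: "t * (1 + Re u) = Im u" using r by (simp add: t_def)
    have "(Re u + t * Im u - 1) * (1 + Re u) = (Re u)\<^sup>2 + Im u * (t * (1 + Re u)) - 1"
      by (simp add: algebra_simps power2_eq_square)
    also have "\<dots> = 0" using u2 by (simp add: t power2_eq_square)
    finally have "Re u + t * Im u = 1" using r by simp
    then have "Complex 1 (- t) * u = Complex 1 t"
      using t by (simp add: complex_eq_iff algebra_simps)
    then show ?thesis using u(3) by (intro exI[of _ 1] exI[of _ t]) (simp add: mult.assoc[symmetric])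
  qed
qed

section \<open>The rational charts\<close>

datatype ('m, 'd) param = Phase 'm | FEntry bool 'm 'd | XEntry bool 'd | YEntry bool 'd

text \<open>
  The indices of \<open>chart_*\<close> mean: \<open>x\<close> is supported in \<open>S\<close> with \<open>x\<^sub>r = 1\<close>, \<open>y\<close> is supported in \<open>T\<close> with
  \<open>y\<^sub>u\<close> real, and \<open>\<langle>x, f\<^sub>j\<rangle> (1 - \<i> t\<^sub>j) = \<sigma>\<^sub>j (1 + \<i> t\<^sub>j) \<langle>y, f\<^sub>j\<rangle>\<close> is solved for the entry \<open>s\<^sub>j\<close> of \<open>f\<^sub>j\<close>.
  The Boolean selects the real or the imaginary part.
\<close>

type_synonym ('m, 'd) chart = "('d set \<times> 'd) \<times> ('d set \<times> 'd) \<times> ('m \<Rightarrow> bool) \<times> ('m \<Rightarrow> 'd)"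

fun chart_params :: "('m, 'd) chart \<Rightarrow> ('m, 'd) param set" where
  "chart_params ((S, r), (T, u), \<sigma>, s) =
    range Phase \<union> (\<lambda>(b, j, i). FEntry b j i) ` (UNIV \<times> Sigma UNIV (\<lambda>j. - {s j}))
    \<union> (\<lambda>(b, i). XEntry b i) ` (UNIV \<times> (S - {r}))
    \<union> (YEntry True ` T \<union> YEntry False ` (T - {u}))"

fun chart_x :: "('m, 'd) chart \<Rightarrow> 'd \<Rightarrow> (('m, 'd) param \<Rightarrow> real) \<Rightarrow> complex" where
  "chart_x ((S, r), _) i g =
    (if i = r then 1 else if i \<in> S then Complex (g (XEntry True i)) (g (XEntry False i)) else 0)"

fun chart_y :: "('m, 'd) chart \<Rightarrow> 'd \<Rightarrow> (('m, 'd) param \<Rightarrow> real) \<Rightarrow> complex" where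
  "chart_y (_, (T, u), _) i g =
    (if i \<in> T then Complex (g (YEntry True i)) (if i = u then 0 else g (YEntry False i)) else 0)"

text \<open>The vector \<open>n\<close> for which the linearised modulus equation reads
  \<open><n, f_j> = 0\<close>. Using \<open>1 - i t\<close> and \<open>1 + i t\<close> instead of
  their quotient keeps its entries polynomial.\<close>

fun chart_normal :: "('m, 'd) chart \<Rightarrow> 'm \<Rightarrow> 'd \<Rightarrow> (('m, 'd) param \<Rightarrow> real) \<Rightarrow> complex" where
  "chart_normal (X, Y, \<sigma>, s) j i g =
    Complex 1 (- g (Phase j)) * chart_x (X, Y, \<sigma>, s) i g -
    (if \<sigma> j then 1 else -1) * Complex 1 (g (Phase j)) * chart_y (X, Y, \<sigma>, s) i g"

fun chart_pivot :: "('m, 'd) chart \<Rightarrow> 'm \<Rightarrow> 'd" where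
  "chart_pivot (_, _, _, s) = s"

text \<open>At the pivot this is the squared modulus of the entry of the normal. A real denominator
  lets the real and imaginary parts of the solved entry be handled separately.\<close>

definition chart_den :: "('m, 'd) chart \<Rightarrow> bool \<times> 'm \<times> 'd \<Rightarrow> (('m, 'd) param \<Rightarrow> real) \<Rightarrow> real" where
  "chart_den \<kappa> = (\<lambda>(b, j, i) g. if i = chart_pivot \<kappa> j
     then Re (chart_normal \<kappa> j i g * cnj (chart_normal \<kappa> j i g)) else 1)"

text \<open>Conjugating \<open><n, f_j> = 0\<close> and multiplying by \<open>n_i\<close> shows that
  \<open>|n_i|^2\<close> times entry \<open>i\<close> of \<open>f_j\<close> is minus this sum; the
  sign is supplied in \<open>chart_num\<close>.\<close>

definition chart_solution ::
    "('m, 'd::finite) chart \<Rightarrow> 'm \<Rightarrow> 'd \<Rightarrow> (('m, 'd) param \<Rightarrow> real) \<Rightarrow> complex" where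
  "chart_solution \<kappa> j i g =
    (\<Sum>l\<in>- {i}. cnj (chart_normal \<kappa> j l g) * chart_normal \<kappa> j i g *
      Complex (g (FEntry True j l)) (g (FEntry False j l)))"

definition chart_num ::
    "('m, 'd::finite) chart \<Rightarrow> bool \<times> 'm \<times> 'd \<Rightarrow> (('m, 'd) param \<Rightarrow> real) \<Rightarrow> real" where
  "chart_num \<kappa> = (\<lambda>(b, j, i) g. if i = chart_pivot \<kappa> j
     then (if b then - Re (chart_solution \<kappa> j i g) else - Im (chart_solution \<kappa> j i g))
     else g (FEntry b j i))"

text \<open>The sets have size exactly \<open>k\<close>: smaller supports are padded, so one
  parameter count serves all charts, and an index \<open>u\<close> exists even for
  \<open>y = 0\<close>.\<close>

definition charts :: "nat \<Rightarrow> ('m, 'd) chart set" where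
  "charts k = {((S, r), (T, u), \<sigma>, s). r \<in> S \<and> u \<in> T \<and> card S = k \<and> card T = k}"

section \<open>Parameter count and polynomiality of the charts\<close>

lemma finite_chart_params: "finite (chart_params (\<kappa> :: ('m::finite, 'd::finite) chart))"
  by (cases \<kappa> rule: chart_params.cases) simp

text \<open>With \<open>m\<close> and \<open>d\<close> the two cardinalities, the phases cost
  \<open>m\<close>, the free entries of the family \<open>2 m (d - 1)\<close>, \<open>x\<close>
  costs \<open>2 (k - 1)\<close> and \<open>y\<close> costs \<open>2 k - 1\<close>. The total
  \<open>m (2 d - 1) + 4 k - 3\<close> is below \<open>2 m d\<close> precisely because
  \<open>m\<close> exceeds \<open>4 k - 3\<close>.\<close>

lemma card_chart_params:
  fixes \<kappa> :: "('m::finite, 'd::finite) chart"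
  assumes "1 \<le> k" "4 * k - 2 \<le> CARD('m)" "\<kappa> \<in> charts k"
  shows "card (chart_params \<kappa>) < CARD(bool \<times> 'm \<times> 'd)"
proof -
  obtain S r T u \<sigma> s where \<kappa>: "\<kappa> = ((S, r), (T, u), \<sigma>, s)" by (cases \<kappa> rule: chart_params.cases)
  have *: "r \<in> S" "u \<in> T" "card S = k" "card T = k" using assms(3) by (auto simp: charts_def \<kappa>)
  let ?m = "CARD('m)" and ?d = "CARD('d)"
  have phase: "card (range (Phase :: 'm \<Rightarrow> ('m, 'd) param)) = ?m"
    by (intro card_image) (simp add: inj_on_def)
  have "card (Sigma (UNIV :: 'm set) (\<lambda>j. - {s j})) = ?m * (?d - 1)"
    by (subst card_SigmaI) (simp_all add: Compl_eq_Diff_UNIV card_Diff_singleton)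
  then have vec: "card ((\<lambda>(b, j, i). FEntry b j i) ` ((UNIV :: bool set) \<times> Sigma (UNIV :: 'm set) (\<lambda>j. - {s j}))) \<le> 2 * (?m * (?d - 1))"
    by (intro order_trans[OF card_image_le]) (simp_all add: card_cartesian_product)
  have x: "card ((\<lambda>(b, i). XEntry b i :: ('m, 'd) param) ` ((UNIV :: bool set) \<times> (S - {r}))) \<le> 2 * (k - 1)"
    using * by (intro order_trans[OF card_image_le]) (simp_all add: card_cartesian_product)
  have "card (YEntry True ` T \<union> YEntry False ` (T - {u}) :: ('m, 'd) param set) \<le> card T + card (T - {u})"
    by (intro order_trans[OF card_Un_le] add_mono card_image_le) simp_all
  also have "\<dots> = k + (k - 1)" using * by simp
  finally have y: "card (YEntry True ` T \<union> YEntry False ` (T - {u}) :: ('m, 'd) param set) \<le> k + (k - 1)" .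
  have "card (chart_params \<kappa>) \<le> ?m + 2 * (?m * (?d - 1)) + 2 * (k - 1) + (k + (k - 1))"
    unfolding \<kappa> chart_params.simps
    by (intro order_trans[OF card_Un_le] add_mono vec x y phase[THEN eq_refl])
  also have "\<dots> < 2 * ?m + 2 * (?m * (?d - 1))" using assms by simp
  also have "\<dots> = 2 * (?m * (?d - 1 + 1))" by (simp add: algebra_simps)
  also have "\<dots> = CARD(bool \<times> 'm \<times> 'd)"
    by (simp add: Suc_leI)
  finally show ?thesis .
qed

lemma is_complex_poly_chart_x:
  fixes \<kappa> :: "('m::finite, 'd::finite) chart"
  shows "is_complex_poly (chart_params \<kappa>) (chart_x \<kappa> i)"
proof -
  obtain S r T u \<sigma> s where \<kappa>: "\<kappa> = ((S, r), (T, u), \<sigma>, s)" by (cases \<kappa> rule: chart_params.cases)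
  have "is_complex_poly (chart_params \<kappa>) (\<lambda>g. Complex (g (XEntry True i)) (g (XEntry False i)))"
    if "i \<in> S" "i \<noteq> r"
    using that by (intro is_complex_poly_Complex is_poly_var finite_chart_params) (auto simp: \<kappa>)
  moreover have "chart_x \<kappa> i = (\<lambda>g. if i = r then 1
      else if i \<in> S then Complex (g (XEntry True i)) (g (XEntry False i)) else 0)"
    by (auto simp: \<kappa>)
  ultimately show ?thesis
    using finite_chart_params[of \<kappa>]
    by (cases "i = r"; cases "i \<in> S") (simp_all add: is_complex_poly_const)
qed

lemma is_complex_poly_chart_y:
  fixes \<kappa> :: "('m::finite, 'd::finite) chart"
  shows "is_complex_poly (chart_params \<kappa>) (chart_y \<kappa> i)"
proof -
  obtain S r T u \<sigma> s where \<kappa>: "\<kappa> = ((S, r), (T, u), \<sigma>, s)" by (cases \<kappa> rule: chart_params.cases)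
  have "is_complex_poly (chart_params \<kappa>) (\<lambda>g. Complex (g (YEntry True i)) (g (YEntry False i)))"
    if "i \<in> T" "i \<noteq> u"
    using that by (intro is_complex_poly_Complex is_poly_var finite_chart_params) (auto simp: \<kappa>)
  moreover have "is_complex_poly (chart_params \<kappa>) (\<lambda>g. Complex (g (YEntry True i)) 0)" if "i \<in> T"
    using that by (intro is_complex_poly_Complex is_poly_var is_poly_const finite_chart_params) (auto simp: \<kappa>)
  moreover have "chart_y \<kappa> i = (\<lambda>g. if i \<in> T then
      Complex (g (YEntry True i)) (if i = u then 0 else g (YEntry False i)) else 0)"
    by (auto simp: \<kappa>)
  ultimately show ?thesis
    using finite_chart_params[of \<kappa>]
    by (cases "i = u"; cases "i \<in> T") (simp_all add: is_complex_poly_const)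
qed

lemma is_complex_poly_chart_normal:
  fixes \<kappa> :: "('m::finite, 'd::finite) chart"
  shows "is_complex_poly (chart_params \<kappa>) (chart_normal \<kappa> j i)"
proof -
  obtain S r T u \<sigma> s where \<kappa>: "\<kappa> = ((S, r), (T, u), \<sigma>, s)" by (cases \<kappa> rule: chart_params.cases)
  have t: "is_poly (chart_params \<kappa>) (\<lambda>g. g (Phase j))"
    by (intro is_poly_var finite_chart_params) (simp add: \<kappa>)
  have "is_complex_poly (chart_params \<kappa>) (\<lambda>g.
    Complex 1 (- g (Phase j)) * chart_x \<kappa> i g -
    (if \<sigma> j then 1 else -1) * Complex 1 (g (Phase j)) * chart_y \<kappa> i g)"
    by (intro is_complex_poly_diff is_complex_poly_mult is_complex_poly_Complex is_poly_uminus
        t is_complex_poly_const is_poly_const finite_chart_params is_complex_poly_chart_x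
        is_complex_poly_chart_y)
  moreover have "chart_normal \<kappa> j i = (\<lambda>g. Complex 1 (- g (Phase j)) * chart_x \<kappa> i g -
    (if \<sigma> j then 1 else -1) * Complex 1 (g (Phase j)) * chart_y \<kappa> i g)"
    unfolding \<kappa> by (rule ext) (rule chart_normal.simps)
  ultimately show ?thesis by simp
qed

lemma is_poly_chart_den:
  fixes \<kappa> :: "('m::finite, 'd::finite) chart"
  shows "is_poly (chart_params \<kappa>) (chart_den \<kappa> q)"
proof -
  obtain b j i where q: "q = (b, j, i)" by (cases q)
  have "is_complex_poly (chart_params \<kappa>) (\<lambda>g. chart_normal \<kappa> j i g * cnj (chart_normal \<kappa> j i g))"
    by (intro is_complex_poly_mult is_complex_poly_cnj is_complex_poly_chart_normal)
  then show ?thesis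
    using is_poly_const[OF finite_chart_params, of \<kappa> 1]
    unfolding is_complex_poly_def chart_den_def q by (cases "i = chart_pivot \<kappa> j") auto
qed

text \<open>The pivot entries of the family are no chart parameters; \<open>chart_solution\<close>
  avoids them since its sum omits the index \<open>i\<close>.\<close>

lemma is_poly_chart_num:
  fixes \<kappa> :: "('m::finite, 'd::finite) chart"
  shows "is_poly (chart_params \<kappa>) (chart_num \<kappa> q)"
proof -
  obtain b j i where q: "q = (b, j, i)" by (cases q)
  have vec: "is_poly (chart_params \<kappa>) (\<lambda>g. g (FEntry b j i))" if "i \<noteq> chart_pivot \<kappa> j" for b i
  proof (intro is_poly_var finite_chart_params)
    obtain S r T u \<sigma> s where \<kappa>: "\<kappa> = ((S, r), (T, u), \<sigma>, s)" by (cases \<kappa> rule: chart_params.cases)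
    have "(b, j, i) \<in> UNIV \<times> Sigma UNIV (\<lambda>j. - {s j})" using that by (simp add: \<kappa>)
    then have "FEntry b j i \<in> (\<lambda>(b, j, i). FEntry b j i) ` (UNIV \<times> Sigma UNIV (\<lambda>j. - {s j}))"
      by (rule rev_image_eqI) simp
    then show "FEntry b j i \<in> chart_params \<kappa>" by (simp only: \<kappa> chart_params.simps Un_iff simp_thms)
  qed
  have "is_complex_poly (chart_params \<kappa>) (chart_solution \<kappa> j i)" if "i = chart_pivot \<kappa> j"
    unfolding chart_solution_def[abs_def] using that
    by (intro is_complex_poly_sum is_complex_poly_mult is_complex_poly_cnj
        is_complex_poly_chart_normal finite_chart_params is_complex_poly_Complex vec) auto
  then show ?thesis
    using vec[of i b]
    unfolding is_complex_poly_def chart_num_def q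
    by (cases "i = chart_pivot \<kappa> j"; cases b) (simp_all add: is_poly_uminus)
qed

section \<open>From a bad pair to a chart\<close>

lemma hermitian_inner_scale: "hermitian_inner (c *s x) y = c * hermitian_inner x y"
  by (simp add: hermitian_inner_def sum_distrib_left mult.assoc)

lemma hermitian_inner_diff_left:
  "hermitian_inner (x - y) z = hermitian_inner x z - hermitian_inner y z"
  by (simp add: hermitian_inner_def left_diff_distrib sum_subtractf)

lemma support_subset_card_eq:
  fixes x :: "complex ^ 'd::finite"
  assumes "x \<in> sparse_vectors k" "k \<le> CARD('d)"
  shows "\<exists>S. card S = k \<and> {i. x $ i \<noteq> 0} \<subseteq> S"
proof -
  have "card {i. x $ i \<noteq> 0} \<le> k" using assms(1) by (simp add: sparse_vectors_def l0_norm_def)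
  then obtain S where "{i. x $ i \<noteq> 0} \<subseteq> S" "card S = k"
    using obtain_subset_with_card_n exists_subset_between[of "{i. x $ i \<noteq> 0}" k UNIV] assms(2) by auto
  then show ?thesis by blast
qed

text \<open>
  Rescaling \<open>x\<close> and \<open>y\<close> by a common complex factor, and \<open>y\<close> by a unimodular one, keeps the
  hypotheses; this normalisation saves three real parameters.
\<close>

lemma normalized_pair:
  fixes F :: "complex ^ 'd::finite ^ 'm"
  assumes "x $ r \<noteq> 0"
    and eq: "\<And>j. cmod (hermitian_inner x (F $ j)) = cmod (hermitian_inner y (F $ j))"
    and ne: "\<not> (\<exists>c. cmod c = 1 \<and> x = c *s y)"
  obtains x' y' where "x' $ r = 1" "Im (y' $ u) = 0"
    "\<And>i. x $ i = 0 \<Longrightarrow> x' $ i = 0" "\<And>i. y $ i = 0 \<Longrightarrow> y' $ i = 0"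
    "\<And>j. cmod (hermitian_inner x' (F $ j)) = cmod (hermitian_inner y' (F $ j))"
    "\<not> (\<exists>c. cmod c = 1 \<and> x' = c *s y')"
proof -
  define a where "a = inverse (x $ r)"
  have a: "a \<noteq> 0" using assms(1) by (simp add: a_def)
  \<comment> \<open>The factor rotates \<open>a * y $ u\<close> onto the positive real axis, or is 1
    if that entry is zero.\<close>
  obtain \<mu> where \<mu>: "cmod \<mu> = 1" "Im (\<mu> * (a * y $ u)) = 0"
  proof (cases "a * y $ u = 0")
    case True
    then show ?thesis by (intro that[of 1]) auto
  next
    case False
    show ?thesis
    proof (rule that)
      show "cmod (cnj (a * y $ u) / cmod (a * y $ u)) = 1"
        using False by (simp add: norm_divide norm_mult)
      have "cnj z / cmod z * z = of_real ((cmod z)\<^sup>2 / cmod z)" for z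
        unfolding of_real_divide complex_norm_square by (simp add: mult.commute)
      then have "Im (cnj z / cmod z * z) = 0" for z by (simp only: Im_complex_of_real)
      then show "Im (cnj (a * y $ u) / cmod (a * y $ u) * (a * y $ u)) = 0" .
    qed
  qed
  show ?thesis
  proof (rule that[of "a *s x" "(\<mu> * a) *s y"])
    show "(a *s x) $ r = 1" using assms(1) by (simp add: a_def)
    show "Im (((\<mu> * a) *s y) $ u) = 0" using \<mu> by (simp add: mult.assoc)
    show "cmod (hermitian_inner (a *s x) (F $ j)) = cmod (hermitian_inner ((\<mu> * a) *s y) (F $ j))" for j
      using eq[of j] \<mu> by (simp add: hermitian_inner_scale norm_mult)
    show "\<not> (\<exists>c. cmod c = 1 \<and> a *s x = c *s ((\<mu> * a) *s y))"
    proof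
      assume "\<exists>c. cmod c = 1 \<and> a *s x = c *s ((\<mu> * a) *s y)"
      then obtain c where c: "cmod c = 1" "a *s x = c *s ((\<mu> * a) *s y)" by blast
      have "a * x $ i = a * ((c * \<mu>) * y $ i)" for i
        using arg_cong[OF c(2), of "\<lambda>v. v $ i"] by (simp add: mult_ac)
      then have "x = (c * \<mu>) *s y" using a by (simp add: vec_eq_iff)
      moreover have "cmod (c * \<mu>) = 1" using c \<mu> by (simp add: norm_mult)
      ultimately show False using ne by blast
    qed
  qed auto
qed

abbreviation real_coords :: "complex ^ 'd ^ 'm \<Rightarrow> bool \<times> 'm \<times> 'd \<Rightarrow> real" where
  "real_coords F \<equiv> \<lambda>(b, j, i). if b then Re (F $ j $ i) else Im (F $ j $ i)"

text \<open>The chart and its parameters are read off from a bad pair: padded supports, a nonzero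
  entry of \<open>x\<close> to normalise, the signs and half-angle tangents of the phases, and for
  each \<open>j\<close> a nonzero entry of the normal as pivot.\<close>

lemma bad_family_in_chart:
  fixes F :: "complex ^ 'd::finite ^ 'm::finite"
  assumes "k \<le> CARD('d)" "x \<in> sparse_vectors k" "y \<in> sparse_vectors k" "x \<noteq> 0"
    and eq: "\<And>j. cmod (hermitian_inner x (F $ j)) = cmod (hermitian_inner y (F $ j))"
    and ne: "\<not> (\<exists>c. cmod c = 1 \<and> x = c *s y)"
  shows "\<exists>\<kappa>\<in>charts k. \<exists>g. \<forall>q. chart_den \<kappa> q g \<noteq> 0 \<and> real_coords F q * chart_den \<kappa> q g = chart_num \<kappa> q g"
proof -
  obtain r where r: "x $ r \<noteq> 0" using assms(4) by (auto simp: vec_eq_iff)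
  obtain S where S: "card S = k" "\<And>i. x $ i \<noteq> 0 \<Longrightarrow> i \<in> S"
    using support_subset_card_eq[OF assms(2,1)] by blast
  obtain T where T: "card T = k" "\<And>i. y $ i \<noteq> 0 \<Longrightarrow> i \<in> T"
    using support_subset_card_eq[OF assms(3,1)] by blast
  \<comment> \<open>As \<open>y\<close> may be zero, \<open>T\<close> is seen to be nonempty by
    comparison with \<open>S\<close>, which contains \<open>r\<close>.\<close>
  have "card S > 0" using S r by (auto simp: card_gt_0_iff)
  then have "T \<noteq> {}" using S T by auto
  then obtain u where u: "u \<in> T" by auto
  obtain x' y' where *: "x' $ r = 1" "Im (y' $ u) = 0"
    "\<And>i. x $ i = 0 \<Longrightarrow> x' $ i = 0" "\<And>i. y $ i = 0 \<Longrightarrow> y' $ i = 0"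
    "\<And>j. cmod (hermitian_inner x' (F $ j)) = cmod (hermitian_inner y' (F $ j))"
    "\<not> (\<exists>c. cmod c = 1 \<and> x' = c *s y')"
    using normalized_pair[OF r eq ne, where u = u] by blast
  have "\<forall>j. \<exists>\<sigma> t. Complex 1 (- t) * hermitian_inner x' (F $ j)
      = (if \<sigma> then 1 else -1) * Complex 1 t * hermitian_inner y' (F $ j)"
    using equal_modulus_linearized[OF *(5)] by (metis (full_types))
  then obtain \<sigma> t where \<sigma>t: "\<And>j. Complex 1 (- t j) * hermitian_inner x' (F $ j)
      = (if \<sigma> j then 1 else -1) * Complex 1 (t j) * hermitian_inner y' (F $ j)"
    by metis
  define v where "v j = Complex 1 (- t j) *s x' - ((if \<sigma> j then 1 else -1) * Complex 1 (t j)) *s y'" for j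
  have orth: "hermitian_inner (v j) (F $ j) = 0" for j
    using \<sigma>t[of j] by (simp only: v_def hermitian_inner_diff_left hermitian_inner_scale) simp
  \<comment> \<open>Otherwise \<open>x'\<close> would be \<open>y'\<close> times a sign times
    \<open>cnj w / w\<close>, which is unimodular.\<close>
  have "v j \<noteq> 0" for j
  proof
    assume "v j = 0"
    define w where "w = Complex 1 (- t j)"
    have w: "w \<noteq> 0" by (simp add: w_def complex_eq_iff)
    have cw: "Complex 1 (t j) = cnj w" by (simp add: w_def complex_eq_iff)
    have "w * x' $ i = (if \<sigma> j then 1 else -1) * cnj w * y' $ i" for i
      using arg_cong[OF \<open>v j = 0\<close>, of "\<lambda>v. v $ i"]
      by (simp only: v_def cw w_def[symmetric]) simp
    then have "x' = ((if \<sigma> j then 1 else -1) * cnj w / w) *s y'"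
      using w by (simp add: vec_eq_iff field_simps)
    moreover have "cmod ((if \<sigma> j then 1 else -1) * cnj w / w) = 1"
      using w by (simp add: norm_mult norm_divide)
    ultimately show False using *(6) by blast
  qed
  then have "\<forall>j. \<exists>i. v j $ i \<noteq> 0" by (auto simp: vec_eq_iff)
  then obtain s where s: "\<And>j. v j $ s j \<noteq> 0" by metis
  define \<kappa> where "\<kappa> = ((S, r), (T, u), \<sigma>, s)"
  define g where "g q = (case q of Phase j \<Rightarrow> t j
    | FEntry b j i \<Rightarrow> if b then Re (F $ j $ i) else Im (F $ j $ i)
    | XEntry b i \<Rightarrow> if b then Re (x' $ i) else Im (x' $ i)
    | YEntry b i \<Rightarrow> if b then Re (y' $ i) else Im (y' $ i))" for q :: "('m, 'd) param"
  have "\<kappa> \<in> charts k" using r S T u by (simp add: charts_def \<kappa>_def)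
  moreover have "chart_den \<kappa> q g \<noteq> 0 \<and> real_coords F q * chart_den \<kappa> q g = chart_num \<kappa> q g" for q
  proof -
    obtain b j i where q: "q = (b, j, i)" by (cases q)
    have x: "chart_x \<kappa> l g = x' $ l" for l
      using *(1) *(3)[of l] S(2)[of l] by (auto simp: \<kappa>_def g_def)
    have y: "chart_y \<kappa> l g = y' $ l" for l
      using *(2) *(4)[of l] T(2)[of l] by (auto simp: \<kappa>_def g_def complex_eq_iff)
    have normal: "chart_normal \<kappa> j l g = v j $ l" for l
    proof -
      have "chart_normal \<kappa> j l g = Complex 1 (- g (Phase j)) * chart_x \<kappa> l g -
          (if \<sigma> j then 1 else -1) * Complex 1 (g (Phase j)) * chart_y \<kappa> l g"
        unfolding \<kappa>_def by (rule chart_normal.simps)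
      then show ?thesis by (simp add: x y v_def g_def)
    qed
    have vec: "Complex (g (FEntry True j l)) (g (FEntry False j l)) = F $ j $ l" for l
      by (simp add: g_def)
    show ?thesis
    proof (cases "i = s j")
      case False
      then show ?thesis by (simp add: q chart_den_def chart_num_def \<kappa>_def g_def)
    next
      case True
      let ?n = "v j $ i" and ?f = "F $ j $ i"
      have pivot: "chart_pivot \<kappa> j = s j" by (simp add: \<kappa>_def)
      have n: "?n * cnj ?n = of_real ((cmod ?n)\<^sup>2)" by (rule complex_norm_square[symmetric])
      have sol: "chart_solution \<kappa> j i g = (\<Sum>l\<in>- {i}. ?n * (cnj (v j $ l) * F $ j $ l))"
        by (simp add: chart_solution_def normal vec mult_ac)
      \<comment> \<open>Conjugation makes the equation linear in the entries of
        \<open>F $ j\<close>; the factor \<open>?n\<close> then makes the coefficient of the pivot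
        entry real.\<close>
      have "(\<Sum>l\<in>UNIV. cnj (v j $ l) * F $ j $ l) = cnj (hermitian_inner (v j) (F $ j))"
        by (simp add: hermitian_inner_def)
      then have "0 = ?n * (\<Sum>l\<in>UNIV. cnj (v j $ l) * F $ j $ l)" by (simp add: orth)
      also have "\<dots> = ?n * (cnj ?n * ?f) + chart_solution \<kappa> j i g"
        by (subst sum.remove[of _ i])
          (simp_all add: sol sum_distrib_left distrib_left Compl_eq_Diff_UNIV)
      also have "?n * (cnj ?n * ?f) = ?f * of_real ((cmod ?n)\<^sup>2)"
        by (simp only: n[symmetric] mult_ac)
      finally have "?f * of_real ((cmod ?n)\<^sup>2) = - chart_solution \<kappa> j i g"
        by (simp only: eq_neg_iff_add_eq_0)
      then have "Re ?f * (cmod ?n)\<^sup>2 = - Re (chart_solution \<kappa> j i g)"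
          "Im ?f * (cmod ?n)\<^sup>2 = - Im (chart_solution \<kappa> j i g)"
        by (simp_all add: complex_eq_iff del: of_real_power)
      moreover have "chart_den \<kappa> q g = (cmod ?n)\<^sup>2"
        unfolding q chart_den_def prod.case normal n pivot if_P[OF True] Re_complex_of_real ..
      moreover have "?n \<noteq> 0" using s True by simp
      moreover have "chart_num \<kappa> q g =
          (if b then - Re (chart_solution \<kappa> j i g) else - Im (chart_solution \<kappa> j i g))"
        using True by (simp add: q chart_num_def \<kappa>_def)
      ultimately show ?thesis by (simp add: q)
    qed
  qed
  ultimately show ?thesis by blast
qed

section \<open>The exceptional hypersurface\<close>

theorem theorem2p2:
  fixes k :: nat
  assumes "1 \<le> k" and "k \<le> CARD('d::finite)" and "4 * k - 2 \<le> CARD('m::finite)"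
  shows "holds_generically (\<lambda>F :: complex ^ 'd ^ 'm. sparse_phase_retrievable k F)"
proof -
  obtain D c where nz: "\<exists>z :: bool \<times> 'm \<times> 'd \<Rightarrow> real. (\<Sum>a\<in>UNIV \<rightarrow> {..D}. c a * lagrange D a z) \<noteq> 0"
    and vanish: "\<And>(\<kappa> :: ('m, 'd) chart) g z. \<kappa> \<in> charts k \<Longrightarrow>
      \<forall>q. chart_den \<kappa> q g \<noteq> 0 \<and> z q * chart_den \<kappa> q g = chart_num \<kappa> q g \<Longrightarrow>
      (\<Sum>a\<in>UNIV \<rightarrow> {..D}. c a * lagrange D a z) = 0"
    using rational_charts_in_hypersurface[of "charts k :: ('m, 'd) chart set" chart_params
        chart_num chart_den, OF finite card_chart_params[OF assms(1,3)]
        is_poly_chart_num is_poly_chart_den]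
    by blast
  \<comment> \<open>Flattens the two real matrices into one point; composed with
    \<open>re_im_parts\<close> it is \<open>real_coords\<close>.\<close>
  define \<phi> :: "(real ^ 'd ^ 'm) \<times> (real ^ 'd ^ 'm) \<Rightarrow> bool \<times> 'm \<times> 'd \<Rightarrow> real"
    where "\<phi> z = (\<lambda>(b, j, i). if b then fst z $ j $ i else snd z $ j $ i)" for z
  define P where "P z = (\<Sum>a\<in>UNIV \<rightarrow> {..D}. c a * lagrange D a (\<phi> z))" for z
  have \<phi>_poly: "real_polynomial_function (\<lambda>z. \<phi> z q)" for q
  proof -
    obtain b j i where q: "q = (b, j, i)" by (cases q)
    have "bounded_linear (\<lambda>z :: (real ^ 'd ^ 'm) \<times> (real ^ 'd ^ 'm). fst z $ j $ i)"
      "bounded_linear (\<lambda>z :: (real ^ 'd ^ 'm) \<times> (real ^ 'd ^ 'm). snd z $ j $ i)"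
      by (intro bounded_linear_compose[OF bounded_linear_vec_nth]
          bounded_linear_fst bounded_linear_snd)+
    then show ?thesis
      unfolding \<phi>_def q by (cases b) (auto intro: real_polynomial_function.intros(1))
  qed
  have "finite ((UNIV :: (bool \<times> 'm \<times> 'd) set) \<rightarrow> {..D})"
    using finite_PiE[of "UNIV :: (bool \<times> 'm \<times> 'd) set" "\<lambda>_. {..D}"] by (simp add: PiE_UNIV_domain)
  then have "real_polynomial_function P"
    unfolding P_def
    by (intro real_polynomial_function_sum real_polynomial_function.intros(4)
        real_polynomial_function.intros(2) real_polynomial_function_lagrange \<phi>_poly)
  moreover have "P \<noteq> (\<lambda>_. 0)"
  proof -
    obtain z where z: "(\<Sum>a\<in>UNIV \<rightarrow> {..D}. c a * lagrange D a z) \<noteq> 0" using nz by blast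
    have "\<phi> ((\<chi> j i. z (True, j, i)), (\<chi> j i. z (False, j, i))) = z"
      by (auto simp: \<phi>_def fun_eq_iff)
    then have "P ((\<chi> j i. z (True, j, i)), (\<chi> j i. z (False, j, i))) \<noteq> 0"
      using z by (simp add: P_def)
    then show ?thesis by (auto simp: fun_eq_iff)
  qed
  \<comment> \<open>The exceptional set is the zero set of the single polynomial
    \<open>P\<close>.\<close>
  ultimately have "proper_real_algebraic {z. \<forall>p\<in>{P}. p z = 0}"
    unfolding proper_real_algebraic_def by blast
  moreover have "P (re_im_parts F) = 0" if bad: "\<not> sparse_phase_retrievable k F" for F
  proof -
    obtain x y where xy: "x \<in> sparse_vectors k" "y \<in> sparse_vectors k"
      "\<And>j. cmod (hermitian_inner x (F $ j)) = cmod (hermitian_inner y (F $ j))"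
      "\<not> (\<exists>c. cmod c = 1 \<and> x = c *s y)"
      using bad unfolding sparse_phase_retrievable_def by blast
    \<comment> \<open>The chart lemma requires its first vector to be nonzero. If
      \<open>x = 0\<close> it is applied to the swapped pair, which is bad as well.\<close>
    have sym: "\<not> (\<exists>c. cmod c = 1 \<and> y = c *s x)"
    proof
      assume "\<exists>c. cmod c = 1 \<and> y = c *s x"
      then obtain c where c: "cmod c = 1" "y = c *s x" by blast
      then have "c \<noteq> 0" by auto
      with c have "cmod (inverse c) = 1" "x = inverse c *s y"
        by (simp_all add: norm_inverse vec_eq_iff mult.assoc[symmetric])
      with xy(4) show False by blast
    qed
    \<comment> \<open>If both vectors vanished, \<open>c = 1\<close> would relate them.\<close>
    have "x \<noteq> 0 \<or> y \<noteq> 0" using xy(4) by (metis norm_one vector_smult_lid)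
    then have "\<exists>\<kappa>\<in>charts k. \<exists>g. \<forall>q. chart_den \<kappa> q g \<noteq> 0 \<and>
        real_coords F q * chart_den \<kappa> q g = chart_num \<kappa> q g"
      using bad_family_in_chart[OF assms(2) xy(1,2) _ xy(3,4)]
        bad_family_in_chart[OF assms(2) xy(2,1) _ xy(3)[symmetric] sym] by (elim disjE)
    then obtain \<kappa> :: "('m, 'd) chart" and g where \<kappa>: "\<kappa> \<in> charts k"
      "\<forall>q. chart_den \<kappa> q g \<noteq> 0 \<and> real_coords F q * chart_den \<kappa> q g = chart_num \<kappa> q g"
      by blast
    have "\<phi> (re_im_parts F) = real_coords F"
      by (auto simp: \<phi>_def re_im_parts_def fun_eq_iff)
    then show ?thesis unfolding P_def using vanish[OF \<kappa>] by simp
  qed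
  ultimately show ?thesis unfolding holds_generically_def by blast
qed

end
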